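(* Let $G$ be a finite connected simple graph (representing a palace), and let $T$ be the tree with $10$ vertices consisting of a central vertex $o$ together with three branches, where branch $i$ ($i=1,2,3$) has vertices $a_i,b_i,c_i$ and edges $\{o,a_i\},\{a_i,b_i\},\{b_i,c_i\}$. If $G$ is a tree not containing any subgraph isomorphic to $T$, then the prince can guarantee to find the princess in $G$. In any other case (that is, if $G$ is not a tree, or $G$ contains a subgraph isomorphic to $T$), the princess can avoid the prince in $G$ indefinitely.
   Context: A palace is a finite connected simple graph $G$; vertices are rooms and edges join adjacent rooms. The game: the princess spends each day $1,2,3,\dots$ at a vertex of $G$ and each night must move to an adjacent vertex (she may not stay put). Each day the prince visits a single vertex of his choice, with no constraint relating the vertices visited on different days and with no information on the position of the princess; he finds her if on some day he visits the vertex where she is. The model is adversarial: the princess knows in advance the whole sequence of vertices that the prince will visit. A walk for the princess is a (finite or infinite) sequence of vertices $w_1,w_2,\dots$ of $G$ such that $w_i$ and $w_{i+1}$ are adjacent for each $i$. "The prince can guarantee to find the princess in $G$" means that there is a finite sequence $(p_1,\dots,p_n)$ of vertices of $G$ such that for every walk $(w_1,\dots,w_n)$ in $G$ there is some $i\in\{1,\dots,n\}$ with $w_i=p_i$. "The princess can avoid the prince indefinitely" means that for every infinite sequence $(p_1,p_2,\dots)$ of vertices of $G$ there is an infinite walk $(w_1,w_2,\dots)$ in $G$ such that $w_i\neq p_i$ for all $i\ge 1$. *)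

theory Defs
  imports "Graph_Theory.Graph_Theory"
begin

text \<open>
  A finite simple graph is a \<^locale>\<open>pair_graph\<close>: each undirected edge is represented by its two
  opposite arcs.  Under this representation every edge is a directed cycle of length two, so the
  library's \<^const>\<open>forest\<close> and \<^const>\<open>tree\<close> are not the undirected notions; only directed cycles
  of length at least three correspond to cycles of the undirected graph.
\<close>

definition undirected_tree :: "'a pair_pre_digraph \<Rightarrow> bool" where
  "undirected_tree G \<longleftrightarrow>
     connected (with_proj G) \<and>
     \<not> (\<exists>p. pre_digraph.cycle (with_proj G) p \<and> 3 \<le> length p)"

text \<open>The centre is 0, and branch i (for i = 1, 2, 3) consists of i, i + 3, i + 6.\<close>

definition three_branch_edges :: "(nat \<times> nat) set" where
  "three_branch_edges = (\<Union>i\<in>{1, 2, 3}. {(0, i), (i, i + 3), (i + 3, i + 6)})"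

definition three_branch_tree :: "nat pair_pre_digraph" where
  "three_branch_tree =
     \<lparr> pverts = {0..9}, parcs = three_branch_edges \<union> three_branch_edges\<inverse> \<rparr>"

definition contains_copy :: "'a pair_pre_digraph \<Rightarrow> 'b pair_pre_digraph \<Rightarrow> bool" where
  "contains_copy G T \<longleftrightarrow>
     (\<exists>H. subgraph (with_proj H) (with_proj G) \<and> digraph_iso (with_proj H) (with_proj T))"

text \<open>
  Days are counted from 0.  The condition \<open>ps \<noteq> []\<close> is needed because \<^const>\<open>vwalk\<close> excludes
  the empty walk, so that the empty sequence of visits would otherwise succeed vacuously.
\<close>

definition prince_can_find :: "'a pair_pre_digraph \<Rightarrow> bool" where
  "prince_can_find G \<longleftrightarrow>
     (\<exists>ps. ps \<noteq> [] \<and> set ps \<subseteq> pverts G \<and>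
        (\<forall>ws. vwalk ws (with_proj G) \<and> length ws = length ps \<longrightarrow>
           (\<exists>i<length ps. ws ! i = ps ! i)))"

definition infinite_walk :: "'a pair_pre_digraph \<Rightarrow> (nat \<Rightarrow> 'a) \<Rightarrow> bool" where
  "infinite_walk G w \<longleftrightarrow> (\<forall>i. w i \<in> pverts G \<and> (w i, w (Suc i)) \<in> parcs G)"

definition princess_can_avoid :: "'a pair_pre_digraph \<Rightarrow> bool" where
  "princess_can_avoid G \<longleftrightarrow>
     (\<forall>p :: nat \<Rightarrow> 'a. (\<forall>i. p i \<in> pverts G) \<longrightarrow>
        (\<exists>w. infinite_walk G w \<and> (\<forall>i. w i \<noteq> p i)))"

lemma pair_graph_three_branch_tree: "pair_graph three_branch_tree"
  by unfold_locales
    (auto simp: three_branch_tree_def three_branch_edges_def symmetric_def sym_def)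

end

theory Submission
  imports Defs
begin

text \<open>
  If a vertex set \<open>C\<close> induces minimum degree two (a cycle), the princess stays in \<open>C\<close> and always has a
  neighbour that the prince does not visit next.  In the three-branch tree, any two vertices
  of the colour class consisting of the centre and the middle vertices jointly have at least four neighbours among
  the six vertices of the other class, so any two such pairs have two common neighbours.  Hence on
  every second day at most one vertex of that class is impossible for the princess, and Koenig's
  lemma turns this into an infinite walk.

  If \<open>G\<close> is a tree without a copy of the three-branch tree, take a longest path \<open>v\<^sub>0, \<dots>, v\<^sub>m\<close>.  A path
  \<open>x, y, z\<close> off the spine that hangs at \<open>v\<^sub>i\<close> would by maximality complete a forbidden copy with centre
  \<open>v\<^sub>i\<close>, so every vertex is within distance two of the spine.  At each \<open>v\<^sub>i\<close> with off-spine neighbours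
  \<open>x\<^sub>1, \<dots>, x\<^sub>k\<close> the prince visits \<open>v\<^sub>i, x\<^sub>1, v\<^sub>i, x\<^sub>2, \<dots>, x\<^sub>k, v\<^sub>i\<close> and then moves on to \<open>v\<^sub>i\<^sub>+\<^sub>1\<close>.  A princess
  with the same parity as the prince is caught by this sweep; repeating it, with one idle day
  if necessary, handles the other parity.
\<close>

section \<open>Possible positions and infinite walks\<close>

text \<open>
  The possible positions of the princess on the day after the visits \<open>ps\<close>, before the prince's next
  visit, if she starts in \<open>A\<close> and has not been found.
\<close>

primrec positions :: "'a rel \<Rightarrow> 'a set \<Rightarrow> 'a list \<Rightarrow> 'a set" where
  "positions E A [] = A"
| "positions E A (p # ps) = positions E (E `` (A - {p})) ps"

lemma positions_append: "positions E A (ps @ qs) = positions E (positions E A ps) qs"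
  by (induction ps arbitrary: A) auto

lemma positions_UN: "positions E (\<Union>x\<in>I. A x) ps = (\<Union>x\<in>I. positions E (A x) ps)"
proof (induction ps arbitrary: A)
  case (Cons p ps)
  have "E `` ((\<Union>x\<in>I. A x) - {p}) = (\<Union>x\<in>I. E `` (A x - {p}))" by auto
  then show ?case using Cons by simp
qed simp

lemma positions_Un: "positions E (A \<union> B) ps = positions E A ps \<union> positions E B ps"
  using positions_UN[of E id "{A, B}" ps] by simp

lemma positions_mono: "A \<subseteq> B \<Longrightarrow> positions E A ps \<subseteq> positions E B ps"
  by (metis positions_Un Un_upper1 subset_Un_eq)

lemma positions_empty [simp]: "positions E {} ps = {}"
  by (induction ps) auto

text \<open>Links walks to \<open>positions\<close>. The walk has one vertex more than
  \<open>ps\<close> has visits, because \<open>positions\<close> describes the day after the last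
  visit.\<close>

lemma last_in_positions:
  assumes "successively (\<lambda>x y. (x, y) \<in> E) ws" "hd ws \<in> A" "length ws = Suc (length ps)"
    and "\<And>i. i < length ps \<Longrightarrow> ws ! i \<noteq> ps ! i"
  shows "last ws \<in> positions E A ps"
  using assms
proof (induction ps arbitrary: ws A)
  case Nil
  then show ?case by (cases ws) auto
next
  case (Cons p ps)
  then obtain w w' ws' where ws: "ws = w # w' # ws'"
    by (metis Suc_length_conv length_Cons)
  have "w \<noteq> p" using Cons.prems(4)[of 0] ws by simp
  then have "last (w' # ws') \<in> positions E (E `` (A - {p})) ps"
    using Cons.prems ws by (intro Cons.IH) (auto, metis Suc_mono nth_Cons_Suc)
  then show ?case using ws by simp
qed

lemma exists_infinite_avoiding_walk:
  assumes "finite V" "E \<subseteq> V \<times> V" and ne: "\<And>n. positions E V (map p [0..<n]) \<noteq> {}"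
  shows "\<exists>w. \<forall>i. w i \<in> V \<and> (w i, w (Suc i)) \<in> E \<and> w i \<noteq> p i"
proof -
  \<comment> \<open>Koenig's lemma: among finitely many starting positions one survives for every horizon.\<close>
  define good where "good i v \<longleftrightarrow> (\<forall>n. positions E {v} (map p [i..<i + n]) \<noteq> {})" for i v
  have survivor: "\<exists>v\<in>A. good i v"
    if "finite A" and nonempty: "\<And>n. positions E A (map p [i..<i + n]) \<noteq> {}" for A i
  proof (rule ccontr)
    assume "\<not> ?thesis"
    then obtain m where m: "\<And>v. v \<in> A \<Longrightarrow> positions E {v} (map p [i..<i + m v]) = {}"
      unfolding good_def by metis
    \<comment> \<open>The sum dominates every \<open>m v\<close>, so it is a common horizon at which
      all starts in \<open>A\<close> have died out.\<close>
    define N where "N = (\<Sum>v\<in>A. m v)"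
    have "positions E {v} (map p [i..<i + N]) = {}" if "v \<in> A" for v
    proof -
      have "m v \<le> N" unfolding N_def using \<open>finite A\<close> that by (simp add: member_le_sum)
      then have "[i..<i + N] = [i..<i + m v] @ [i + m v..<i + N]"
        using upt_add_eq_append[of i "i + m v" "N - m v"] by simp
      then show ?thesis using m[OF that] by (simp add: positions_append)
    qed
    then have "positions E (\<Union>v\<in>A. {v}) (map p [i..<i + N]) = {}"
      unfolding positions_UN by blast
    then show False using nonempty[of N] by simp
  qed
  have start: "\<exists>v. v \<in> V \<and> good 0 v"
    using survivor[OF assms(1), of 0] ne by auto
  have good_avoids: "v \<noteq> p i" if "good i v" for i v
    using that unfolding good_def by (auto dest!: spec[of _ 1])
  \<comment> \<open>\<open>good i v\<close> rules out \<open>v = p i\<close>, so the visit does not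
    touch \<open>v\<close>, and \<open>survivor\<close> applied to the neighbours of
    \<open>v\<close> yields a good successor.\<close>
  have step: "\<exists>w. (w \<in> V \<and> good (Suc i) w) \<and> (v, w) \<in> E" if v: "v \<in> V \<and> good i v" for i v
  proof -
    have "positions E (E `` {v}) (map p [Suc i..<Suc i + n]) \<noteq> {}" for n
    proof -
      have "[i..<i + Suc n] = i # [Suc i..<Suc i + n]" by (simp add: upt_conv_Cons)
      moreover have "positions E {v} (map p [i..<i + Suc n]) \<noteq> {}"
        using v unfolding good_def by blast
      moreover have "{v} - {p i} = {v}" using good_avoids v by blast
      ultimately show ?thesis by (metis list.simps(9) positions.simps(2))
    qed
    moreover have "finite (E `` {v})" using assms finite_subset[of "E `` {v}" V] by blast
    ultimately obtain w where "w \<in> E `` {v}" "good (Suc i) w" using survivor by meson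
    then show ?thesis using assms by auto
  qed
  obtain w where "\<forall>i. (w i \<in> V \<and> good i (w i)) \<and> (w i, w (Suc i)) \<in> E"
    using dependent_nat_choice[of "\<lambda>i v. v \<in> V \<and> good i v" "\<lambda>i v w. (v, w) \<in> E"] start step by metis
  then show ?thesis using good_avoids by meson
qed

section \<open>The princess avoids the prince\<close>

lemma princess_can_avoid_if_min_degree_2:
  assumes "C \<subseteq> pverts G" "C \<noteq> {}"
    and deg: "\<And>x. x \<in> C \<Longrightarrow> \<exists>y\<in>C. \<exists>z\<in>C. y \<noteq> z \<and> (x, y) \<in> parcs G \<and> (x, z) \<in> parcs G"
  shows "princess_can_avoid G"
  unfolding princess_can_avoid_def
proof (intro allI impI)
  fix p :: "nat \<Rightarrow> 'a"
  have "\<exists>x. x \<in> C \<and> x \<noteq> p 0" using assms(2) deg by (metis all_not_in_conv)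
  moreover have "\<exists>y. (y \<in> C \<and> y \<noteq> p (Suc i)) \<and> (x, y) \<in> parcs G" if "x \<in> C \<and> x \<noteq> p i" for x i
    using deg that by metis
  ultimately obtain w where "\<forall>i. (w i \<in> C \<and> w i \<noteq> p i) \<and> (w i, w (Suc i)) \<in> parcs G"
    using dependent_nat_choice[of "\<lambda>i x. x \<in> C \<and> x \<noteq> p i" "\<lambda>i x y. (x, y) \<in> parcs G"] by metis
  then show "\<exists>w. infinite_walk G w \<and> (\<forall>i. w i \<noteq> p i)"
    using assms(1) unfolding infinite_walk_def by blast
qed

lemma (in pair_pre_digraph) pawalk_verts_eq: "pcas u p v \<Longrightarrow> pawalk_verts u p = u # map snd p"
  by (induction p arbitrary: u) auto

lemma pcas_nth:
  "pcas u p v \<Longrightarrow> Suc i < length p \<Longrightarrow> fst (p ! Suc i) = snd (p ! i)"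
proof (induction p arbitrary: u i)
  case (Cons e p)
  then show ?case by (cases i; cases p) auto
qed simp

lemma pcas_ends: "pcas u p v \<Longrightarrow> p \<noteq> [] \<Longrightarrow> fst (hd p) = u \<and> snd (last p) = v"
  by (induction p arbitrary: u) (auto split: if_splits)

text \<open>Length at least three makes the predecessor and the successor of a vertex on the cycle
  distinct.\<close>

lemma princess_can_avoid_if_cycle:
  assumes "pair_graph G" "pre_digraph.cycle (with_proj G) p" "3 \<le> length p"
  shows "princess_can_avoid G"
proof -
  interpret pair_graph G by fact
  obtain u where u: "u \<in> pverts G" "set p \<subseteq> parcs G" "pcas u p u" "distinct (map snd p)"
    using assms(2) unfolding cycle_def awalk_def
    by (auto simp: pawalk_verts_eq)
  show ?thesis
  proof (rule princess_can_avoid_if_min_degree_2)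
    show "set (map snd p) \<subseteq> pverts G" using u(2) in_arcsD2 by auto
    show "set (map snd p) \<noteq> {}" using assms(3) by auto
    fix x assume "x \<in> set (map snd p)"
    then obtain i where i: "i < length p" "x = snd (p ! i)" by (auto simp: in_set_conv_nth)
    \<comment> \<open>Arc \<open>i\<close> enters \<open>x\<close>. Cyclically, \<open>j\<close> is
      the arc after it and \<open>k\<close> the arc before it, so \<open>snd (p ! j)\<close> and
      \<open>snd (p ! k)\<close> are the neighbours of \<open>x\<close> on the cycle.\<close>
    define j where "j = (if Suc i < length p then Suc i else 0)"
    define k where "k = (if 0 < i then i - 1 else length p - 1)"
    have jk: "j < length p" "k < length p" "j \<noteq> k"
      using i(1) assms(3) unfolding j_def k_def by auto
    have ends: "fst (p ! 0) = snd (p ! (length p - 1))"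
    proof -
      have "p \<noteq> []" using assms(3) by auto
      then show ?thesis using pcas_ends[OF u(3)] by (simp add: hd_conv_nth last_conv_nth)
    qed
    have "fst (p ! j) = x"
    proof (cases "Suc i < length p")
      case True
      then show ?thesis using i pcas_nth[OF u(3)] by (simp add: j_def)
    next
      case False
      then have "j = 0" "i = length p - 1" using i(1) by (simp_all add: j_def)
      then show ?thesis using i ends by simp
    qed
    moreover have "fst (p ! i) = snd (p ! k)"
    proof (cases "0 < i")
      case True
      then show ?thesis using i pcas_nth[OF u(3), of "i - 1"] by (simp add: k_def)
    next
      case False
      then show ?thesis using ends by (simp add: k_def)
    qed
    moreover have "p ! j \<in> parcs G" "p ! i \<in> parcs G" using u(2) jk i by auto
    ultimately have "(x, snd (p ! j)) \<in> parcs G" "(snd (p ! k), x) \<in> parcs G"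
      using i by (metis prod.collapse)+
    moreover have "snd (p ! j) \<noteq> snd (p ! k)"
      using u(4) jk by (metis length_map nth_eq_iff_index_eq nth_map)
    moreover have "snd (p ! j) \<in> set (map snd p)" "snd (p ! k) \<in> set (map snd p)"
      using jk by auto
    ultimately show "\<exists>y\<in>set (map snd p). \<exists>z\<in>set (map snd p).
        y \<noteq> z \<and> (x, y) \<in> parcs G \<and> (x, z) \<in> parcs G"
      using arcs_symmetric by metis
  qed
qed

text \<open>Subgraphs need not be induced, so a copy amounts to an injective vertex map preserving
  arcs.\<close>

lemma contains_copy_iff:
  assumes "pair_wf_digraph G" "pair_wf_digraph T"
  shows "contains_copy G T \<longleftrightarrow>
    (\<exists>f. inj_on f (pverts T) \<and> f ` pverts T \<subseteq> pverts G \<and>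
      (\<forall>(a, b)\<in>parcs T. (f a, f b) \<in> parcs G))"
proof
  assume "contains_copy G T"
  then obtain H h where H: "subgraph (with_proj H) (with_proj G)"
    and h: "pre_digraph.digraph_isomorphism (with_proj H) h"
    and T: "with_proj T = app_iso h (with_proj H)"
    unfolding contains_copy_def digraph_iso_def by blast
  define f where "f = the_inv_into (pverts H) (iso_verts h)"
  have inj: "inj_on (iso_verts h) (pverts H)"
    using h unfolding pre_digraph.digraph_isomorphism_def by simp
  have T': "pverts T = iso_verts h ` pverts H" "parcs T = iso_arcs h ` parcs H"
    "fst = iso_tail h" "snd = iso_head h"
    using T by (metis with_proj_simps app_iso_simps)+
  interpret H: wf_digraph "with_proj H" using H by auto
  have "bij_betw f (pverts T) (pverts H)"
    unfolding f_def T' using bij_betw_the_inv_into[OF inj_on_imp_bij_betw[OF inj]] .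
  moreover have "pverts H \<subseteq> pverts G" "parcs H \<subseteq> parcs G"
    using H by (simp_all add: subgraph_def)
  moreover have "(f a, f b) \<in> parcs H" if "(a, b) \<in> parcs T" for a b
  proof -
    obtain e where e: "e \<in> parcs H" "(a, b) = iso_arcs h e" using \<open>(a, b) \<in> parcs T\<close> T' by auto
    then have "iso_verts h (fst e) = iso_tail h (a, b)" "iso_verts h (snd e) = iso_head h (a, b)"
      using h unfolding pre_digraph.digraph_isomorphism_def by auto
    then have "iso_verts h (fst e) = a" "iso_verts h (snd e) = b"
      using T'(3,4) by (metis fst_conv snd_conv)+
    moreover have "fst e \<in> pverts H" "snd e \<in> pverts H"
      using e(1) H.wellformed by auto
    ultimately have "f a = fst e" "f b = snd e"
      unfolding f_def using the_inv_into_f_f[OF inj] by auto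
    then show ?thesis using e(1) by simp
  qed
  ultimately show "\<exists>f. inj_on f (pverts T) \<and> f ` pverts T \<subseteq> pverts G \<and>
      (\<forall>(a, b)\<in>parcs T. (f a, f b) \<in> parcs G)"
    by (intro exI[of _ f]) (auto simp: bij_betw_def)
next
  interpret G: pair_wf_digraph G by fact
  interpret T: pair_wf_digraph T by fact
  assume "\<exists>f. inj_on f (pverts T) \<and> f ` pverts T \<subseteq> pverts G \<and>
      (\<forall>(a, b)\<in>parcs T. (f a, f b) \<in> parcs G)"
  then obtain f where f: "inj_on f (pverts T)" "f ` pverts T \<subseteq> pverts G"
    "\<And>a b. (a, b) \<in> parcs T \<Longrightarrow> (f a, f b) \<in> parcs G" by fast
  define H where "H = \<lparr> pverts = f ` pverts T, parcs = map_prod f f ` parcs T \<rparr>"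
  have H_simps [simp]: "pverts H = f ` pverts T" "parcs H = map_prod f f ` parcs T"
    by (simp_all add: H_def)
  define g where "g = the_inv_into (pverts T) f"
  have g: "g (f a) = a" if "a \<in> pverts T" for a
    unfolding g_def using the_inv_into_f_f[OF f(1) that] .
  interpret H: pair_wf_digraph H
    by unfold_locales (auto dest: T.in_arcsD1 T.in_arcsD2)
  have "subgraph (with_proj H) (with_proj G)"
    using f(2,3) by (auto simp: subgraph_def compatible_def intro: G.wf_digraph_axioms H.wf_digraph_axioms)
  moreover have "digraph_iso (with_proj H) (with_proj T)"
    unfolding digraph_iso_def
  proof (intro exI conjI)
    let ?h = "\<lparr> iso_verts = g, iso_arcs = map_prod g g, iso_head = snd, iso_tail = fst \<rparr>"
    have g_arc: "map_prod g g (map_prod f f e) = e" if "e \<in> parcs T" for e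
      using that g T.arc_fst_in_verts T.arc_snd_in_verts by (cases e) fastforce
    have "inj_on g (f ` pverts T)" using g by (auto intro: inj_onI)
    moreover have "inj_on (map_prod g g) (map_prod f f ` parcs T)"
      by (rule inj_on_inverseI[where g = "map_prod f f"]) (metis g_arc imageE)
    ultimately show "pre_digraph.digraph_isomorphism (with_proj H) ?h"
      unfolding pre_digraph.digraph_isomorphism_def
      using H.wf_digraph_axioms by auto
    have "g ` f ` pverts T = pverts T" using g by force
    moreover have "map_prod g g ` map_prod f f ` parcs T = parcs T"
      unfolding image_image using g_arc by simp
    ultimately show "with_proj T = app_iso ?h (with_proj H)"
      by (simp add: with_proj_def app_iso_def)
  qed
  ultimately show "contains_copy G T" unfolding contains_copy_def by blast
qed

lemma princess_can_avoid_supergraph: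
  fixes f :: "'a \<Rightarrow> 'b"
  assumes "princess_can_avoid T" and "pverts T \<noteq> {}" and "inj_on f (pverts T)"
    and "f ` pverts T \<subseteq> pverts G" and arc: "\<And>a b. (a, b) \<in> parcs T \<Longrightarrow> (f a, f b) \<in> parcs G"
  shows "princess_can_avoid G"
  unfolding princess_can_avoid_def
proof (intro allI impI)
  fix p :: "nat \<Rightarrow> 'b"
  obtain t where t: "t \<in> pverts T" using assms(2) by blast
  \<comment> \<open>Visits are pulled back along \<open>f\<close>. A visit outside the copy
    threatens nothing there, so the default \<open>t\<close> merely adds a vertex to avoid.\<close>
  define q where
    "q i = (if p i \<in> f ` pverts T then the_inv_into (pverts T) f (p i) else t)" for i
  have "q i \<in> pverts T" for i
    unfolding q_def using t assms(3) by (auto simp: the_inv_into_f_f)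
  then obtain w where w: "infinite_walk T w" "\<And>i. w i \<noteq> q i"
    using assms(1) unfolding princess_can_avoid_def by blast
  have "f (w i) \<noteq> p i" for i
    using w(2)[of i] w(1) assms(3) unfolding q_def infinite_walk_def
    by (metis image_eqI the_inv_into_f_f)
  then show "\<exists>w. infinite_walk G w \<and> (\<forall>i. w i \<noteq> p i)"
    using w(1) assms(4) arc unfolding infinite_walk_def
    by (intro exI[of _ "\<lambda>i. f (w i)"]) blast
qed

text \<open>The colour classes of the three-branch tree are \<open>{0, 4, 5, 6}\<close> and \<open>{1, 2, 3, 7, 8, 9}\<close>.\<close>

lemma three_branch_common_neighbours:
  "\<forall>x\<in>{0, 4, 5, 6}. \<forall>y\<in>{0, 4, 5, 6}. x \<noteq> y \<longrightarrow>
   (\<forall>b\<in>{0, 4, 5, 6}. \<forall>c\<in>{0, 4, 5, 6}. b \<noteq> c \<longrightarrow>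
     (\<exists>m\<in>{1, 2, 3, 7, 8, 9}. \<exists>m'\<in>{1, 2, 3, 7, 8, 9}. m \<noteq> m' \<and>
       (\<forall>k\<in>{m, m'}. ((x, k) \<in> parcs three_branch_tree \<or> (y, k) \<in> parcs three_branch_tree) \<and>
         ((k, b) \<in> parcs three_branch_tree \<or> (k, c) \<in> parcs three_branch_tree))))"
  unfolding three_branch_tree_def three_branch_edges_def by simp

lemma princess_can_avoid_three_branch_tree: "princess_can_avoid three_branch_tree"
  unfolding princess_can_avoid_def
proof (intro allI impI)
  fix p :: "nat \<Rightarrow> nat"
  let ?V = "pverts three_branch_tree" and ?E = "parcs three_branch_tree"
  let ?B = "{0, 4, 5, 6} :: nat set"
  \<comment> \<open>At most one vertex of the class \<open>?B\<close> is missing from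
    \<open>R\<close>.\<close>
  define big where
    "big R \<longleftrightarrow> (\<forall>b\<in>?B. \<forall>c\<in>?B. b \<noteq> c \<longrightarrow> b \<in> R \<or> c \<in> R)" for R :: "nat set"
  have big_step: "big (?E `` (?E `` (R - {u}) - {v}))" if R: "big R" for R u v
  proof -
    \<comment> \<open>At least three vertices of \<open>?B\<close> lie in \<open>R\<close>, and
      \<open>u\<close> removes at most one. Of the two common neighbours of the pairs
      \<open>x, y\<close> and \<open>b, c\<close>, one then escapes the visit
      \<open>v\<close>.\<close>
    obtain x y where "x \<in> ?B" "y \<in> ?B" "x \<noteq> y" "x \<in> R - {u}" "y \<in> R - {u}"
    proof -
      have "\<exists>x\<in>?B. \<exists>y\<in>?B. x \<noteq> y \<and> x \<in> R - {u} \<and> y \<in> R - {u}"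
        using R unfolding big_def
        by (cases "u = 0"; cases "u = 4"; cases "u = 5"; cases "u = 6"; simp; blast)
      then show thesis using that by blast
    qed
    show ?thesis
      unfolding big_def
    proof (intro ballI impI)
      fix b c assume bc: "b \<in> ?B" "c \<in> ?B" "b \<noteq> c"
      obtain m m' where "m \<noteq> m'" and m: "\<And>k. k \<in> {m, m'} \<Longrightarrow>
          ((x, k) \<in> ?E \<or> (y, k) \<in> ?E) \<and> ((k, b) \<in> ?E \<or> (k, c) \<in> ?E)"
        using three_branch_common_neighbours[rule_format, OF \<open>x \<in> ?B\<close> \<open>y \<in> ?B\<close> \<open>x \<noteq> y\<close> bc] by blast
      then obtain k where "k \<in> {m, m'}" "k \<noteq> v" by blast
      then have "k \<in> ?E `` (R - {u}) - {v}"
        using m[of k] \<open>x \<in> R - {u}\<close> \<open>y \<in> R - {u}\<close> by blast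
      then show "b \<in> ?E `` (?E `` (R - {u}) - {v}) \<or> c \<in> ?E `` (?E `` (R - {u}) - {v})"
        using m[OF \<open>k \<in> {m, m'}\<close>] by blast
    qed
  qed
  have "big (positions ?E ?V (map p [0..<2 * n]))" for n
  proof (induction n)
    case 0
    then show ?case by (simp add: big_def three_branch_tree_def)
  next
    case (Suc n)
    then show ?case using big_step by (simp add: positions_append)
  qed
  then have "positions ?E ?V (map p [0..<2 * n]) \<noteq> {}" for n
    unfolding big_def by (metis empty_iff insertCI zero_neq_numeral)
  \<comment> \<open>Extinction is permanent, so survival of \<open>2 * n\<close> visits implies
    survival of the first \<open>n\<close>, whatever the parity of \<open>n\<close>.\<close>
  moreover have "positions ?E ?V (map p [0..<2 * n]) =
      positions ?E (positions ?E ?V (map p [0..<n])) (map p [n..<2 * n])" for n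
    using upt_add_eq_append[of 0 n n] by (simp add: positions_append mult_2)
  ultimately have "positions ?E ?V (map p [0..<n]) \<noteq> {}" for n
    by (metis positions_empty)
  note nonempty = this
  interpret pair_graph three_branch_tree by (rule pair_graph_three_branch_tree)
  have "finite ?V" "?E \<subseteq> ?V \<times> ?V"
    using pair_finite_verts in_arcsD1 in_arcsD2 by auto
  then obtain w where "\<forall>i. w i \<in> ?V \<and> (w i, w (Suc i)) \<in> ?E \<and> w i \<noteq> p i"
    using exists_infinite_avoiding_walk[OF _ _ nonempty] by blast
  then show "\<exists>w. infinite_walk three_branch_tree w \<and> (\<forall>i. w i \<noteq> p i)"
    unfolding infinite_walk_def by blast
qed

section \<open>Sweeping along a path\<close>

definition winnable :: "'a set \<Rightarrow> 'a rel \<Rightarrow> 'a set \<Rightarrow> bool" where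
  "winnable V E A \<longleftrightarrow> (\<exists>ps. set ps \<subseteq> V \<and> positions E A ps = {})"

lemma winnable_mono: "winnable V E B \<Longrightarrow> A \<subseteq> B \<Longrightarrow> winnable V E A"
  unfolding winnable_def using positions_mono by (metis subset_empty)

lemma winnable_step: "winnable V E (E `` (A - {p})) \<Longrightarrow> p \<in> V \<Longrightarrow> winnable V E A"
  unfolding winnable_def by (metis insert_subset list.simps(15) positions.simps(2))

lemma winnable_positions:
  "winnable V E (positions E A ps) \<Longrightarrow> set ps \<subseteq> V \<Longrightarrow> winnable V E A"
  unfolding winnable_def by (metis le_sup_iff positions_append set_append)

text \<open>The extra visit \<open>v\<close> makes the sequence nonempty and gives the walk the
  additional vertex that \<open>last_in_positions\<close> asks for.\<close>

lemma prince_can_find_if_winnable: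
  assumes "winnable (pverts G) (parcs G) (pverts G)" "pverts G \<noteq> {}"
  shows "prince_can_find G"
proof -
  obtain ps v where ps: "set ps \<subseteq> pverts G" "positions (parcs G) (pverts G) ps = {}"
    and v: "v \<in> pverts G"
    using assms unfolding winnable_def by blast
  have "\<exists>i<length (ps @ [v]). ws ! i = (ps @ [v]) ! i"
    if "vwalk ws (with_proj G)" "length ws = length (ps @ [v])" for ws
  proof (rule ccontr)
    assume "\<not> ?thesis"
    then have "ws ! i \<noteq> ps ! i" if "i < length ps" for i
      using that by (metis length_append_singleton less_SucI nth_append)
    moreover have "set (vwalk_arcs ws) \<subseteq> parcs G \<Longrightarrow> successively (\<lambda>x y. (x, y) \<in> parcs G) ws"
      for ws :: "'a list"
      by (induction ws rule: vwalk_arcs.induct) auto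
    ultimately have "last ws \<in> positions (parcs G) (pverts G) ps"
      using that by (intro last_in_positions) (auto simp: vwalk_def)
    then show False using ps by simp
  qed
  then show ?thesis
    unfolding prince_can_find_def using ps v by (intro exI[of _ "ps @ [v]"]) auto
qed

text \<open>Visits that clear \<open>P\<close> leave only what came from \<open>Q\<close>, and this
  lies in a single class. If that class is \<open>Q\<close>, an arbitrary visit to \<open>v\<close>
  first moves it into \<open>P\<close>.\<close>

lemma winnable_bipartite:
  assumes "P \<inter> Q = {}" "V = P \<union> Q" "E `` P \<subseteq> Q" "E `` Q \<subseteq> P" "winnable V E P" "v \<in> V"
  shows "winnable V E V"
proof -
  obtain ps where ps: "set ps \<subseteq> V" "positions E P ps = {}"
    using assms(5) unfolding winnable_def by blast
  have "\<forall>A \<subseteq> P. positions E A qs \<subseteq> P \<or> positions E A qs \<subseteq> Q"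
    and *: "\<forall>A \<subseteq> Q. positions E A qs \<subseteq> P \<or> positions E A qs \<subseteq> Q" for qs
  proof (induction qs)
    case (Cons q qs)
    have "E `` (A - {q}) \<subseteq> Q" if "A \<subseteq> P" for A using that assms(3) by blast
    moreover have "E `` (A - {q}) \<subseteq> P" if "A \<subseteq> Q" for A using that assms(4) by blast
    ultimately show "\<forall>A \<subseteq> P. positions E A (q # qs) \<subseteq> P \<or> positions E A (q # qs) \<subseteq> Q"
      and "\<forall>A \<subseteq> Q. positions E A (q # qs) \<subseteq> P \<or> positions E A (q # qs) \<subseteq> Q"
      using Cons by auto
  qed auto
  have "E `` (Q - {v}) \<subseteq> P" using assms(4) by blast
  then have "winnable V E Q"
    using winnable_mono[OF assms(5)] winnable_step[OF _ assms(6)] by blast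
  moreover have "positions E V ps = positions E Q ps"
    using ps(2) by (simp add: assms(2) positions_Un)
  ultimately have "winnable V E (positions E V ps)"
    using *[of ps] assms(5) winnable_mono by (metis order_refl)
  then show ?thesis using winnable_positions ps(1) by blast
qed

text \<open>Abstracts what the sweep needs: \<open>pos x\<close> is the index of the spine vertex
  below \<open>x\<close>, and \<open>lvl x\<close> plays the role of the distance to the
  spine.\<close>

locale layered_over_path =
  fixes V :: "'a set" and E :: "'a rel" and v :: "nat \<Rightarrow> 'a" and n :: nat
    and pos lvl :: "'a \<Rightarrow> nat"
  assumes finite_V: "finite V"
    and sym_E: "sym E"
    and E_subset: "E \<subseteq> V \<times> V"
    and v_in_V: "i < n \<Longrightarrow> v i \<in> V"
    and pos_less: "x \<in> V \<Longrightarrow> pos x < n"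
    and lvl_le: "x \<in> V \<Longrightarrow> lvl x \<le> 2"
    and lvl_0: "x \<in> V \<Longrightarrow> lvl x = 0 \<Longrightarrow> x = v (pos x)"
    and edge: "(x, y) \<in> E \<Longrightarrow> lvl x \<le> lvl y \<Longrightarrow>
      (lvl x = 0 \<and> lvl y = 0 \<and> (pos y = Suc (pos x) \<or> pos x = Suc (pos y))) \<or>
      (lvl y = Suc (lvl x) \<and> pos y = pos x)"
    and parent_unique: "(x, y) \<in> E \<Longrightarrow> (x', y) \<in> E \<Longrightarrow> lvl y = 2 \<Longrightarrow> x = x'"
begin

text \<open>
  The positions still possible just before the prince visits \<open>v i\<close>, when everything behind \<open>v i\<close> and
  the branches at \<open>v i\<close> rooted in \<open>X\<close> are cleared, for a princess of the same parity as the prince.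
\<close>

definition ahead :: "nat \<Rightarrow> 'a set \<Rightarrow> 'a set" where
  "ahead i X = {a \<in> V. even (pos a + lvl a + i) \<and>
     (pos a > i \<or> (pos a = i \<and> (\<forall>x\<in>X. lvl a = 2 \<longrightarrow> (x, a) \<notin> E)))}"

lemma edge_cases:
  assumes "(x, y) \<in> E"
  obtains "x \<in> V" "y \<in> V" "(y, x) \<in> E" "lvl x = 0" "lvl y = 0"
      "pos y = Suc (pos x) \<or> pos x = Suc (pos y)"
  | "x \<in> V" "y \<in> V" "(y, x) \<in> E" "lvl y = Suc (lvl x)" "pos y = pos x"
  | "x \<in> V" "y \<in> V" "(y, x) \<in> E" "lvl x = Suc (lvl y)" "pos y = pos x"
  using edge[of x y] edge[of y x] assms E_subset symD[OF sym_E assms]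
  by (metis SigmaD1 SigmaD2 nat_le_linear subsetD)

lemma edge_parity: "(x, y) \<in> E \<Longrightarrow> even (pos x + lvl x) \<noteq> even (pos y + lvl y)"
  by (erule edge_cases) auto

text \<open>Parity decides. At position \<open>i\<close> only level 2 remains besides
  \<open>v i\<close>, and from there she must descend to a root outside \<open>X\<close>. At
  position \<open>i + 1\<close> she is on level 1, so she cannot step back to
  \<open>v i\<close>.\<close>

lemma after_visit:
  assumes "y \<in> E `` (ahead i X - {v i})"
  shows "y \<in> V \<and> odd (pos y + lvl y + i) \<and>
    (pos y > i \<or> (pos y = i \<and> lvl y = 1 \<and> y \<notin> X))"
proof -
  obtain a where a: "a \<in> ahead i X" "a \<noteq> v i" and E: "(a, y) \<in> E" using assms by auto
  have aV: "a \<in> V" "even (pos a + lvl a + i)"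
    "pos a > i \<or> (pos a = i \<and> (\<forall>x\<in>X. lvl a = 2 \<longrightarrow> (x, a) \<notin> E))"
    using a(1) unfolding ahead_def by auto
  have a0: "lvl a \<noteq> 0" if "pos a = i" using lvl_0[OF aV(1)] a(2) that by auto
  have parity: "odd (pos y + lvl y + i)" using edge_parity[OF E] aV(2) by auto
  show ?thesis
    using E
  proof (cases rule: edge_cases)
    case 1
    then show ?thesis using aV a0 parity
      by (cases "pos a = Suc i") auto
  next
    case 2
    then show ?thesis using aV a0 parity lvl_le[of y]
      by (cases "lvl a = 1") auto
  next
    case 3
    then show ?thesis using aV a0 parity lvl_le[of a]
      by (cases "lvl y = 0") auto
  qed
qed

text \<open>To be on level 2 at position \<open>i\<close> she must climb from a root other than
  \<open>x\<close>; by \<open>parent_unique\<close> that vertex is then not in the branch of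
  \<open>x\<close>.\<close>

lemma visit_branch:
  assumes "x \<in> V" "lvl x = 1" "pos x = i"
  shows "E `` (E `` (ahead i X - {v i}) - {x}) \<subseteq> ahead i (insert x X)"
proof
  fix a assume "a \<in> E `` (E `` (ahead i X - {v i}) - {x})"
  then obtain y where y: "y \<in> E `` (ahead i X - {v i})" "y \<noteq> x" and E: "(y, a) \<in> E" by auto
  note y' = after_visit[OF y(1)]
  have parity: "even (pos a + lvl a + i)" using edge_parity[OF E] y' by auto
  show "a \<in> ahead i (insert x X)"
    using E
  proof (cases rule: edge_cases)
    case 1
    then show ?thesis using y' parity unfolding ahead_def by auto
  next
    case 2
    then have "(z, a) \<notin> E" if "lvl a = 2" "pos a = i" "z \<in> insert x X" for z
      using parent_unique[OF E, of z] that y' y(2) by auto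
    then show ?thesis using 2 y' parity unfolding ahead_def by auto
  next
    case 3
    then show ?thesis using y' parity unfolding ahead_def by auto
  qed
qed

text \<open>Once all roots at \<open>i\<close> are in \<open>X\<close>, \<open>after_visit\<close>
  leaves only later positions, and the flipped parity is the one required for
  \<open>Suc i\<close>.\<close>

lemma advance: "E `` (ahead i {x \<in> V. lvl x = 1 \<and> pos x = i} - {v i}) \<subseteq> ahead (Suc i) {}"
proof
  fix y assume "y \<in> E `` (ahead i {x \<in> V. lvl x = 1 \<and> pos x = i} - {v i})"
  from after_visit[OF this] show "y \<in> ahead (Suc i) {}"
    unfolding ahead_def by auto
qed

lemma winnable_ahead:
  assumes "i \<le> n"
  shows "winnable V E (ahead i {})"
  using assms
proof (induction i rule: inc_induct)
  case base
  have "ahead n {} = {}" using pos_less unfolding ahead_def by fastforce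
  then show ?case unfolding winnable_def by (intro exI[of _ "[]"]) auto
next
  case (step i)
  let ?L = "{x \<in> V. lvl x = 1 \<and> pos x = i}"
  have vi: "v i \<in> V" using step v_in_V by simp
  \<comment> \<open>\<open>Y\<close> is the set of roots whose branches are still to be cleared:
    \<open>Y = {}\<close> permits \<open>advance\<close>, and \<open>Y = ?L\<close> is the
    goal.\<close>
  have "winnable V E (ahead i (?L - Y))" if "finite Y" "Y \<subseteq> ?L" for Y
    using that
  proof (induction Y rule: finite_induct)
    case empty
    show ?case using winnable_step[OF winnable_mono[OF step.IH advance] vi] by simp
  next
    case (insert x Y)
    have "?L - Y = insert x (?L - insert x Y)" using insert by auto
    then have "E `` (E `` (ahead i (?L - insert x Y) - {v i}) - {x}) \<subseteq> ahead i (?L - Y)"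
      using visit_branch[of x i "?L - insert x Y"] insert by auto
    then have "winnable V E (E `` (E `` (ahead i (?L - insert x Y) - {v i}) - {x}))"
      using winnable_mono insert by blast
    moreover have "x \<in> V" using insert.prems by blast
    ultimately show ?case using winnable_step vi by metis
  qed
  from this[of ?L] show ?case using finite_V by simp
qed

lemma winnable_all: "winnable V E V"
proof (cases "V = {}")
  case True
  then show ?thesis unfolding winnable_def by (intro exI[of _ "[]"]) auto
next
  case False
  then obtain x where x: "x \<in> V" by blast
  let ?P = "{x \<in> V. even (pos x + lvl x)}"
  let ?Q = "{x \<in> V. odd (pos x + lvl x)}"
  have "?P \<subseteq> ahead 0 {}" unfolding ahead_def by auto
  then have "winnable V E ?P" using winnable_ahead winnable_mono by blast
  moreover have "E `` ?P \<subseteq> ?Q" "E `` ?Q \<subseteq> ?P" using edge_parity E_subset by blast+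
  ultimately show ?thesis using x by (intro winnable_bipartite[of ?P ?Q V E x]) auto
qed

end

section \<open>The shape of a tree without the three-branch tree\<close>

context pair_graph
begin

abbreviation simple_path :: "'a list \<Rightarrow> bool" where
  "simple_path us \<equiv> distinct us \<and> set us \<subseteq> pverts G \<and> successively (\<lambda>x y. (x, y) \<in> parcs G) us"

lemma simple_path_rev:
  assumes "simple_path us"
  shows "simple_path (rev us)"
proof -
  have "successively (\<lambda>x y. (y, x) \<in> parcs G) us"
    using assms by (blast intro: successively_mono arcs_symmetric)
  then show ?thesis using assms by simp
qed

lemma cycle_if_closed_path:
  assumes "distinct us" "successively (\<lambda>x y. (x, y) \<in> parcs G) us"
    and "(last us, hd us) \<in> parcs G" "us \<noteq> []"
  shows "\<exists>p. cycle p \<and> length p = length us"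
proof -
  \<comment> \<open>The end \<open>u\<close> is arbitrary because the induction changes the head of
    the list while the closing arc stays fixed.\<close>
  have closed: "pcas (hd us) (vwalk_arcs us @ [(last us, u)]) u \<and>
      map snd (vwalk_arcs us @ [(last us, u)]) = tl us @ [u] \<and>
      (successively (\<lambda>x y. (x, y) \<in> parcs G) us \<longrightarrow> set (vwalk_arcs us) \<subseteq> parcs G)"
    if "us \<noteq> []" for us and u :: 'a
    using that by (induction us rule: vwalk_arcs.induct) auto
  let ?p = "vwalk_arcs us @ [(last us, hd us)]"
  have p: "pcas (hd us) ?p (hd us)" "map snd ?p = tl us @ [hd us]" "set ?p \<subseteq> parcs G"
    using closed[OF assms(4), of "hd us"] assms(2,3) by auto
  have "distinct (tl us @ [hd us])" using assms(1,4) by (cases us) auto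
  then have "cycle ?p"
    unfolding cycle_def awalk_def using p assms(3) in_arcsD2[OF assms(3)]
    by (intro exI[of _ "hd us"]) (simp add: pawalk_verts_eq)
  moreover have "length ?p = length us"
    using arg_cong[OF p(2), of length] assms(4) by (cases us) auto
  ultimately show ?thesis by blast
qed

lemma exists_longest_simple_path:
  assumes "pverts G \<noteq> {}"
  obtains vs where "simple_path vs" "vs \<noteq> []" "\<And>us. simple_path us \<Longrightarrow> length us \<le> length vs"
proof -
  obtain a where "a \<in> pverts G" using assms by blast
  then have "simple_path [a]" by simp
  moreover have "length us < Suc (card (pverts G))" if "simple_path us" for us
    using that card_mono[OF pair_finite_verts, of "set us"] by (simp add: distinct_card)
  ultimately obtain vs where "simple_path vs" "\<forall>us. simple_path us \<longrightarrow> length us \<le> length vs"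
    using ex_has_greatest_nat[of simple_path "[a]" length "Suc (card (pverts G))"] by auto
  moreover have "vs \<noteq> []" using calculation \<open>simple_path [a]\<close> by fastforce
  ultimately show thesis using that by blast
qed

end

locale spine = pair_graph +
  fixes vs :: "'a list"
  assumes connected: "connected (with_proj G)"
    and acyclic: "\<not> (\<exists>p. cycle p \<and> 3 \<le> length p)"
    and no_copy: "\<not> contains_copy G three_branch_tree"
    and path: "simple_path vs" "vs \<noteq> []"
    and longest: "simple_path us \<Longrightarrow> length us \<le> length vs"
begin

text \<open>The spine from \<open>vs ! i\<close> to \<open>vs ! j\<close> followed by
  \<open>q\<close> would close up to a cycle of length at least three. The \<open>hd\<close> and
  \<open>last\<close> forms also admit an empty \<open>q\<close>, that is, a chord.\<close>

lemma no_long_ear: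
  assumes "i \<le> j" "j < length vs" "simple_path q" "set q \<inter> set vs = {}"
    and "(vs ! j, hd (q @ [vs ! i])) \<in> parcs G" "(last (vs ! j # q), vs ! i) \<in> parcs G"
  shows "j - i + length q < 2"
proof (rule ccontr)
  assume long: "\<not> ?thesis"
  define us where "us = take (Suc (j - i)) (drop i vs)"
  have len: "length us = Suc (j - i)" using assms(1,2) by (simp add: us_def)
  have ends: "hd us = vs ! i" "last us = vs ! j" "us \<noteq> []"
    using assms(1,2) len by (auto simp: us_def hd_drop_conv_nth last_conv_nth)
  have "set us \<subseteq> set vs"
    unfolding us_def using set_take_subset set_drop_subset by fastforce
  moreover have "successively (\<lambda>x y. (x, y) \<in> parcs G) us"
    using path(1) len unfolding us_def successively_conv_nth by auto
  moreover have "distinct us" using path(1) by (simp add: us_def)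
  moreover have "hd (us @ q) = vs ! i" "last (us @ q) = last (vs ! j # q)"
    using ends by auto
  ultimately have "\<exists>p. cycle p \<and> length p = length (us @ q)"
    using assms ends by (intro cycle_if_closed_path) (auto simp: successively_append_iff)
  then show False using acyclic long len by auto
qed

lemma no_long_ear_sym:
  assumes "i < length vs" "j < length vs" "simple_path q" "set q \<inter> set vs = {}"
    and "q \<noteq> []" "(vs ! i, hd q) \<in> parcs G" "(last q, vs ! j) \<in> parcs G"
  shows "length q < 2 \<and> i = j"
proof -
  have q: "0 < length q" using assms(5) by simp
  show ?thesis
  proof (cases "i \<le> j")
    case True
    then have "j - i + length (rev q) < 2"
      using assms simple_path_rev[OF assms(3)] arcs_symmetric
      by (intro no_long_ear) (auto simp: hd_rev last_rev)
    then show ?thesis using True q unfolding length_rev by linarith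
  next
    case False
    then have "i - j + length q < 2" using assms by (intro no_long_ear) auto
    then show ?thesis using False q by linarith
  qed
qed

lemma no_chord:
  assumes "i < length vs" "j < length vs" "(vs ! i, vs ! j) \<in> parcs G"
  shows "j = Suc i \<or> i = Suc j"
proof -
  have "i \<noteq> j" using assms pair_no_loops by force
  moreover have "max i j - min i j + length ([] :: 'a list) < 2"
    using assms arcs_symmetric by (intro no_long_ear) (auto simp: max_def min_def)
  ultimately show ?thesis by (auto simp: max_def min_def split: if_splits)
qed

lemma no_deep_branch:
  assumes "i < length vs" "distinct [x, y, z]" "set [x, y, z] \<inter> set vs = {}"
    and arcs: "(vs ! i, x) \<in> parcs G" "(x, y) \<in> parcs G" "(y, z) \<in> parcs G"
  shows False
proof -
  interpret T: pair_graph three_branch_tree by (rule pair_graph_three_branch_tree)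
  have verts: "{x, y, z} \<subseteq> pverts G" using arcs in_arcsD2 by auto
  have off: "{x, y, z} \<inter> set (take k vs) = {}" "{x, y, z} \<inter> set (drop k vs) = {}" for k
    using assms(3) set_take_subset[of k vs] set_drop_subset[of k vs] by auto
  have sub: "set (take k vs) \<subseteq> pverts G" "set (drop k vs) \<subseteq> pverts G" for k
    using path(1) set_take_subset[of k vs] set_drop_subset[of k vs] by auto
  have "take (Suc i) vs \<noteq> []" "last (take (Suc i) vs) = vs ! i"
    using take_Suc_conv_app_nth[OF assms(1)] by simp_all
  then have "simple_path (take (Suc i) vs @ [x, y, z])"
    using path(1) assms verts off[of "Suc i"] sub[of "Suc i"]
    by (auto simp: successively_append_iff successively_conv_nth[of _ "take _ _"]
        successively_conv_nth[of _ vs])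
  \<comment> \<open>The branch \<open>x, y, z\<close> could replace either end of the spine, so both ends have length at least 3.\<close>
  from longest[OF this] have i4: "i + 3 < length vs" using assms(1) by simp
  have "simple_path ([z, y, x] @ drop i vs)"
    using path(1) assms verts off[of i] sub[of i] arcs_symmetric
    by (auto simp: successively_append_iff successively_Cons successively_conv_nth[of _ "drop _ _"]
        successively_conv_nth[of _ vs] hd_drop_conv_nth)
  from longest[OF this] have i3: "3 \<le> i" using assms(1) by simp
  define k where "k = i - 3"
  have i: "i = k + 3" using i3 by (simp add: k_def)
  \<comment> \<open>Indexed by the labels of \<open>three_branch_tree\<close>: entry 0 is the
    centre, and each branch occupies entries \<open>b\<close>, \<open>b + 3\<close>,
    \<open>b + 6\<close> for \<open>b\<close> = 1, 2, 3.\<close>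
  let ?ts = "[vs ! (k + 3), x, vs ! (k + 2), vs ! (k + 4), y, vs ! (k + 1), vs ! (k + 5),
    z, vs ! k, vs ! (k + 6)]"
  have nth: "vs ! a \<noteq> vs ! b" if "a < length vs" "b < length vs" "a \<noteq> b" for a b
    using that path(1) nth_eq_iff_index_eq by blast
  have notin: "vs ! a \<noteq> x" "vs ! a \<noteq> y" "vs ! a \<noteq> z" "x \<noteq> vs ! a" "y \<noteq> vs ! a" "z \<noteq> vs ! a"
    if "a < length vs" for a
    using that assms(3) by auto
  have dist: "distinct ?ts" using i4 i assms(2) nth notin by simp
  have sub_ts: "set ?ts \<subseteq> pverts G" using i4 i verts path(1) by (auto intro: nth_mem)
  have step: "(vs ! a, vs ! Suc a) \<in> parcs G" "(vs ! Suc a, vs ! a) \<in> parcs G"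
    if "Suc a < length vs" for a
    using that path(1) arcs_symmetric by (auto simp: successively_conv_nth)
  have "(?ts ! a, ?ts ! b) \<in> parcs G \<and> (?ts ! b, ?ts ! a) \<in> parcs G"
    if "(a, b) \<in> three_branch_edges" for a b
    using that i4 i arcs arcs_symmetric step[of k] step[of "k + 1"] step[of "k + 2"]
      step[of "k + 3"] step[of "k + 4"] step[of "k + 5"]
    unfolding three_branch_edges_def by (auto simp: numeral_eq_Suc)
  then have arc: "(?ts ! a, ?ts ! b) \<in> parcs G" if "(a, b) \<in> parcs three_branch_tree" for a b
    using that unfolding three_branch_tree_def by auto
  have verts_T: "pverts three_branch_tree = {..<length ?ts}"
    unfolding three_branch_tree_def by auto
  have "contains_copy G three_branch_tree"
    unfolding contains_copy_iff[OF pair_wf_digraph_axioms T.pair_wf_digraph_axioms]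
  proof (intro exI conjI)
    show "inj_on ((!) ?ts) (pverts three_branch_tree)"
      unfolding verts_T using dist by (auto simp: inj_on_def nth_eq_iff_index_eq simp del: distinct.simps)
    show "(!) ?ts ` pverts three_branch_tree \<subseteq> pverts G"
      unfolding verts_T using sub_ts nth_mem[of _ ?ts] by blast
    show "\<forall>(a, b)\<in>parcs three_branch_tree. (?ts ! a, ?ts ! b) \<in> parcs G"
      using arc by blast
  qed
  then show False using no_copy by simp
qed

text \<open>The value 2 is a default for all remaining vertices; \<open>exists_hangs_at\<close>
  shows that they are indeed at distance two from the spine.\<close>

definition lvl :: "'a \<Rightarrow> nat" where
  "lvl x = (if x \<in> set vs then 0 else if \<exists>y\<in>set vs. (y, x) \<in> parcs G then 1 else 2)"

text \<open>A relation, since existence and uniqueness of the foot on the spine are not yet known; a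
  choice of foot later serves as \<open>pos\<close>.\<close>

definition hangs_at :: "'a \<Rightarrow> nat \<Rightarrow> bool" where
  "hangs_at x i \<longleftrightarrow> i < length vs \<and>
     (x = vs ! i \<or>
      x \<notin> set vs \<and> (vs ! i, x) \<in> parcs G \<or>
      lvl x = 2 \<and> (\<exists>y. y \<notin> set vs \<and> (vs ! i, y) \<in> parcs G \<and> (y, x) \<in> parcs G))"

lemma lvl_eq:
  "lvl x = 0 \<longleftrightarrow> x \<in> set vs"
  "lvl x = Suc 0 \<longleftrightarrow> x \<notin> set vs \<and> (\<exists>y\<in>set vs. (y, x) \<in> parcs G)"
  "lvl x = 2 \<longleftrightarrow> x \<notin> set vs \<and> \<not> (\<exists>y\<in>set vs. (y, x) \<in> parcs G)"
  by (auto simp: lvl_def)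

text \<open>
  The set of vertices that hang somewhere is closed under adjacency, so by connectedness it is
  everything.
\<close>

lemma exists_hangs_at:
  assumes "x \<in> pverts G"
  shows "\<exists>i. hangs_at x i"
proof -
  have closed: "\<exists>j. hangs_at y j" if x: "hangs_at x i" and xy: "(x, y) \<in> parcs G" for x y i
  proof (cases "lvl y = 2")
    case False
    then consider "y \<in> set vs" | "y \<notin> set vs" "\<exists>u\<in>set vs. (u, y) \<in> parcs G"
      by (auto simp: lvl_def split: if_splits)
    then show ?thesis
      unfolding hangs_at_def by cases (auto simp: in_set_conv_nth)
  next
    case True
    have i: "i < length vs" "x \<noteq> vs ! i"
      using x True xy unfolding hangs_at_def lvl_eq by auto
    then consider "x \<notin> set vs" "(vs ! i, x) \<in> parcs G"
      | u where "lvl x = 2" "u \<notin> set vs" "(vs ! i, u) \<in> parcs G" "(u, x) \<in> parcs G"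
      using x unfolding hangs_at_def by auto
    then show ?thesis
    proof cases
      case 1
      then show ?thesis using i(1) True xy unfolding hangs_at_def by auto
    next
      case 2
      \<comment> \<open>A level 2 neighbour \<open>y\<close> of the level 2 vertex \<open>x\<close>
        would make \<open>u, x, y\<close> a branch of depth three.\<close>
      then have "u \<noteq> x" "x \<noteq> y" "u \<noteq> y"
        using i(1) True xy pair_no_loops unfolding lvl_eq by force+
      then show ?thesis
        using no_deep_branch[OF i(1) _ _ 2(3,4) xy] 2 True unfolding lvl_eq by auto
    qed
  qed
  have "hd vs \<in> pverts G" using path by auto
  then have "hd vs \<rightarrow>\<^sup>*\<^bsub>with_proj G\<^esub> x"
    using symmetric_connected_imp_strongly_connected[OF pair_sym_arcs connected] assms
    by (auto simp: strongly_connected_def)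
  then show ?thesis
  proof (induction rule: reachable_induct)
    case base
    then show ?case using path(2) by (auto simp: hangs_at_def hd_conv_nth)
  next
    case (step y z)
    then show ?case using closed by auto
  qed
qed

lemma hangs_at_cases:
  assumes "hangs_at x i"
  obtains "i < length vs" "lvl x = 0" "x = vs ! i" "x \<in> set vs"
  | "i < length vs" "lvl x = Suc 0" "x \<notin> set vs" "(vs ! i, x) \<in> parcs G"
  | u where "i < length vs" "lvl x = 2" "x \<notin> set vs" "lvl u = Suc 0" "u \<notin> set vs"
      "(vs ! i, u) \<in> parcs G" "(u, x) \<in> parcs G" "u \<noteq> x"
proof -
  have i: "i < length vs" using assms by (simp add: hangs_at_def)
  consider "x = vs ! i" | "x \<notin> set vs" "(vs ! i, x) \<in> parcs G"
    | u where "lvl x = 2" "u \<notin> set vs" "(vs ! i, u) \<in> parcs G" "(u, x) \<in> parcs G"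
    using assms unfolding hangs_at_def by blast
  then show thesis
  proof cases
    case 1
    then show thesis using i that(1) by (simp add: lvl_eq)
  next
    case 2
    then have "lvl x = Suc 0" using i unfolding lvl_eq by auto
    then show thesis using i 2 that(2) by blast
  next
    case 3
    then have "lvl u = Suc 0" "x \<notin> set vs" using i unfolding lvl_eq by auto
    then show thesis using i 3 that(3) by fastforce
  qed
qed

text \<open>Every other kind of edge is excluded either by a cycle through the spine (a chord or an
  ear) or by a branch of depth three.\<close>

lemma hangs_at_edge:
  assumes x: "hangs_at x i" and y: "hangs_at y j" and xy: "(x, y) \<in> parcs G" and le: "lvl x \<le> lvl y"
  shows "(lvl x = 0 \<and> lvl y = 0 \<and> (j = Suc i \<or> i = Suc j)) \<or> (lvl y = Suc (lvl x) \<and> j = i)"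
proof -
  have neq: "x \<noteq> y" using pair_no_loops xy by force
  have verts: "x \<in> pverts G" "y \<in> pverts G" using xy in_arcsD1 in_arcsD2 by auto
  show ?thesis
    using y
  proof (cases rule: hangs_at_cases)
    case 1
    then show ?thesis using x le no_chord[of i j] xy by (auto elim!: hangs_at_cases)
  next
    case 2
    from x show ?thesis
    proof (cases rule: hangs_at_cases)
      case 1
      then show ?thesis
        using 2 no_long_ear_sym[of i j "[y]"] xy verts arcs_symmetric by auto
    next
      case x1: 2
      then show ?thesis
        using 2 no_long_ear_sym[of i j "[x, y]"] xy verts neq arcs_symmetric by auto
    next
      case 3
      then show ?thesis using 2 le by simp
    qed
  next
    case (3 u)
    from x show ?thesis
    proof (cases rule: hangs_at_cases)
      case 1
      then show ?thesis using 3 xy unfolding lvl_eq by auto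
    next
      case x1: 2
      \<comment> \<open>Otherwise \<open>u, y, x\<close> is a deep branch at \<open>vs ! j\<close>.
        With \<open>u = x\<close>, both feet are adjacent to \<open>x\<close>, and the ear
        \<open>[x]\<close> forces them to agree.\<close>
      have "u = x"
      proof (rule ccontr)
        assume "u \<noteq> x"
        then show False
          using no_deep_branch[of j u y x] 3 x1 neq xy arcs_symmetric by auto
      qed
      then show ?thesis
        using 3 x1 no_long_ear_sym[of i j "[x]"] verts arcs_symmetric by auto
    next
      case (3 w)
      then have "w \<noteq> y" using \<open>lvl y = 2\<close> by auto
      then show ?thesis
        using no_deep_branch[of i w x y] 3 \<open>y \<notin> set vs\<close> neq xy by auto
    qed
  qed
qed

lemma winnable: "winnable (pverts G) (parcs G) (pverts G)"
proof -
  obtain pos where pos: "\<And>x. x \<in> pverts G \<Longrightarrow> hangs_at x (pos x)"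
    using exists_hangs_at by metis
  interpret layered_over_path "pverts G" "parcs G" "(!) vs" "length vs" pos lvl
  proof
    show "finite (pverts G)" by (rule pair_finite_verts)
    show "sym (parcs G)" using arcs_symmetric by (auto intro: symI)
    show "parcs G \<subseteq> pverts G \<times> pverts G" using in_arcsD1 in_arcsD2 by auto
    show "vs ! i \<in> pverts G" if "i < length vs" for i using that path(1) by auto
    show "pos x < length vs" if "x \<in> pverts G" for x
      using pos[OF that] by (simp add: hangs_at_def)
    show "lvl x \<le> 2" for x by (simp add: lvl_def)
    show "x = vs ! pos x" if "x \<in> pverts G" "lvl x = 0" for x
      using pos[OF that(1)] that(2) by (auto elim!: hangs_at_cases)
    show "(lvl x = 0 \<and> lvl y = 0 \<and> (pos y = Suc (pos x) \<or> pos x = Suc (pos y))) \<or>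
        (lvl y = Suc (lvl x) \<and> pos y = pos x)" if "(x, y) \<in> parcs G" "lvl x \<le> lvl y" for x y
      using hangs_at_edge[OF pos pos] that in_arcsD1 in_arcsD2 by metis
    show "x = x'" if "(x, y) \<in> parcs G" "(x', y) \<in> parcs G" "lvl y = 2" for x y x'
    proof (rule ccontr)
      assume "x \<noteq> x'"
      have parent: "u \<notin> set vs \<and> u \<noteq> y \<and> (vs ! pos u, u) \<in> parcs G \<and> pos u < length vs"
        if uy: "(u, y) \<in> parcs G" for u
      proof -
        have hang: "hangs_at u (pos u)" "hangs_at y (pos y)"
          using pos uy in_arcsD1 in_arcsD2 by blast+
        have "lvl u \<le> lvl y" using \<open>lvl y = 2\<close> by (simp add: lvl_def)
        then have "lvl u = Suc 0" using hangs_at_edge[OF hang uy] \<open>lvl y = 2\<close> by simp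
        then show ?thesis using hang(1) \<open>lvl y = 2\<close> by (auto elim!: hangs_at_cases)
      qed
      \<comment> \<open>Two parents of \<open>y\<close> would give the deep branch
        \<open>x, y, x'\<close> at the foot of \<open>x\<close>.\<close>
      show False
        using no_deep_branch[of "pos x" x y x'] parent[OF that(1)] parent[OF that(2)]
          that \<open>x \<noteq> x'\<close> arcs_symmetric unfolding lvl_eq by auto
    qed
  qed
  show ?thesis by (rule winnable_all)
qed

end

section \<open>The characterisation\<close>

theorem theorem1:
  fixes G :: "'a pair_pre_digraph"
  assumes "pair_graph G" and "connected (with_proj G)"
  shows "(undirected_tree G \<and> \<not> contains_copy G three_branch_tree \<longrightarrow> prince_can_find G) \<and>
         (\<not> undirected_tree G \<or> contains_copy G three_branch_tree \<longrightarrow> princess_can_avoid G)"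
proof (intro conjI impI)
  interpret pair_graph G by fact
  have nonempty: "pverts G \<noteq> {}"
    using symmetric_connected_imp_strongly_connected[OF pair_sym_arcs assms(2)]
    by (auto simp: strongly_connected_def)
  {
    assume tree: "undirected_tree G \<and> \<not> contains_copy G three_branch_tree"
    obtain vs where "simple_path vs" "vs \<noteq> []" "\<And>us. simple_path us \<Longrightarrow> length us \<le> length vs"
      using exists_longest_simple_path[OF nonempty] by blast
    then interpret spine G vs
      using tree by unfold_locales (auto simp: undirected_tree_def)
    show "prince_can_find G"
      using winnable nonempty by (rule prince_can_find_if_winnable)
  next
    assume "\<not> undirected_tree G \<or> contains_copy G three_branch_tree"
    then show "princess_can_avoid G"
    proof
      assume "\<not> undirected_tree G"
      then show ?thesis
        using assms princess_can_avoid_if_cycle unfolding undirected_tree_def by blast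
    next
      interpret T: pair_graph three_branch_tree by (rule pair_graph_three_branch_tree)
      assume "contains_copy G three_branch_tree"
      then obtain f where "inj_on f (pverts three_branch_tree)"
        "f ` pverts three_branch_tree \<subseteq> pverts G"
        "\<And>a b. (a, b) \<in> parcs three_branch_tree \<Longrightarrow> (f a, f b) \<in> parcs G"
        unfolding contains_copy_iff[OF pair_wf_digraph_axioms T.pair_wf_digraph_axioms] by fast
      moreover have "pverts three_branch_tree \<noteq> {}" by (simp add: three_branch_tree_def)
      ultimately show ?thesis
        using princess_can_avoid_supergraph[OF princess_can_avoid_three_branch_tree] by metis
    qed
  }
qed

end
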